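(* Let $F:\mathbb{R}^d\to\mathbb{R}$ be twice continuously differentiable and suppose there exist positive constants $\mu, L$ such that $\mu I \preceq \nabla^2 F(w) \preceq L I$ for all $w\in\mathbb{R}^d$. Let $F^\star = F(w^\star)$, where $w^\star$ is the minimizer of $F$. Let $\{w_k\}$ be the iterates generated by the sampled LBFGS (S-LBFGS) method from the starting point $w_0$, i.e. $w_{k+1} = w_k - \alpha_k H_k\nabla F(w_k)$ with $H_k$ the S-LBFGS inverse Hessian approximations, and let $0<\mu_1\le\mu_2$ be constants such that $\mu_1 I\preceq H_k\preceq \mu_2 I$ for all $k=0,1,2,\dots$. Let $0<c_1<1$ and $\tau\in(0,1)$, and suppose that $\alpha_k$ is the maximum value in $\{\tau^{j}: j=0,1,\dots\}$ satisfying $$F(w_k-\alpha_kH_k\nabla F(w_k))\le F(w_k)-c_1\alpha_k\nabla F(w_k)^TH_k\nabla F(w_k).$$ Then, for all $k\ge 0$, $$F(w_k)-F^\star\le\left(1-\frac{4\mu\mu_1^2c_1(1-c_1)\tau}{\mu_2^2L}\right)^k[F(w_0)-F^\star].$$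
   Context: S-LBFGS method with memory $m\ge 1$ and sampling radius $r>0$. At iteration $k$, given $w_k$: for $j=1,\dots,m$ sample a (nonzero, otherwise arbitrary) random direction $\sigma_j\in\mathbb{R}^d$, set $\bar w_j=w_k+r\sigma_j$, $s_{k,j}=w_k-\bar w_j$, and either $y_{k,j}=\nabla F(w_k)-\nabla F(\bar w_j)$ (Option I) or $y_{k,j}=\nabla^2F(w_k)s_{k,j}$ (Option II). The results hold for both options. The inverse Hessian approximation is $H_k=B_k^{-1}$, where $B_k=B_k^{(m)}$ is obtained from $B_k^{(0)}=\frac{y_{k,l}^Ty_{k,l}}{s_{k,l}^Ty_{k,l}}I$ (with $l$ chosen uniformly at random from $\{1,\dots,m\}$) by the updates, for $i=1,\dots,m$, $$B_k^{(i)}=B_k^{(i-1)}-\frac{B_k^{(i-1)}s_{k,i}s_{k,i}^TB_k^{(i-1)}}{s_{k,i}^TB_k^{(i-1)}s_{k,i}}+\frac{y_{k,i}y_{k,i}^T}{y_{k,i}^Ts_{k,i}}.$$ Then $w_{k+1}=w_k-\alpha_kH_k\nabla F(w_k)$. $A\preceq B$ means $B-A$ is positive semidefinite. Constants $\mu_1,\mu_2$ as in the claim are known to exist under the stated hypotheses on $F$. *)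

theory Defs
  imports "HOL-Analysis.Analysis"
begin

definition gradient :: "(real^'d \<Rightarrow> real) \<Rightarrow> real^'d \<Rightarrow> real^'d" where
  "gradient F x = (THE g. GDERIV F x :> g)"

definition hessian :: "(real^'d \<Rightarrow> real) \<Rightarrow> real^'d \<Rightarrow> real^'d^'d" where
  "hessian F x = jacobian (gradient F) (at x)"

definition twice_cont_differentiable :: "(real^'d \<Rightarrow> real) \<Rightarrow> bool" where
  "twice_cont_differentiable F \<longleftrightarrow>
     (\<forall>x. F differentiable (at x)) \<and>
     (\<forall>x. gradient F differentiable (at x)) \<and>
     continuous_on UNIV (hessian F)"

definition psd :: "real^'d^'d \<Rightarrow> bool" where
  "psd A \<longleftrightarrow> transpose A = A \<and> (\<forall>x. 0 \<le> x \<bullet> (A *v x))"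

definition loewner_le :: "real^'d^'d \<Rightarrow> real^'d^'d \<Rightarrow> bool"  (infix \<open>\<preceq>\<^sub>L\<close> 50) where
  "A \<preceq>\<^sub>L B \<longleftrightarrow> psd (B - A)"

definition outer_product :: "real^'d \<Rightarrow> real^'d \<Rightarrow> real^'d^'d" where
  "outer_product u v = (columnvector u :: real^1^'d) ** (rowvector v :: real^'d^1)"

definition bfgs_update :: "real^'d^'d \<Rightarrow> real^'d \<Rightarrow> real^'d \<Rightarrow> real^'d^'d" where
  "bfgs_update B s y =
     B - (1 / (s \<bullet> (B *v s))) *\<^sub>R (B ** outer_product s s ** B)
       + (1 / (y \<bullet> s)) *\<^sub>R outer_product y y"

text \<open>
  The curvature pairs are families \<open>s j\<close>, \<open>y j\<close> indexed by \<open>j = 1, \<dots>, m\<close>; the value at \<open>0\<close>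
  is never used. The index \<open>l\<close> selects the pair that scales the initial matrix, and
  \<open>bfgs_matrix s y l i\<close> is the matrix after processing the pairs \<open>1, \<dots>, i\<close> in this order.
\<close>
primrec bfgs_matrix ::
  "(nat \<Rightarrow> real^'d) \<Rightarrow> (nat \<Rightarrow> real^'d) \<Rightarrow> nat \<Rightarrow> nat \<Rightarrow> real^'d^'d" where
  "bfgs_matrix s y l 0 = ((y l \<bullet> y l) / (s l \<bullet> y l)) *\<^sub>R mat 1"
| "bfgs_matrix s y l (Suc i) = bfgs_update (bfgs_matrix s y l i) (s (Suc i)) (y (Suc i))"

datatype curvature_mode = Option_I | Option_II

definition sample_point :: "real \<Rightarrow> real^'d \<Rightarrow> real^'d \<Rightarrow> real^'d" where
  "sample_point r w \<sigma> = w + r *\<^sub>R \<sigma>"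

definition sample_s :: "real \<Rightarrow> real^'d \<Rightarrow> real^'d \<Rightarrow> real^'d" where
  "sample_s r w \<sigma> = w - sample_point r w \<sigma>"

fun sample_y ::
  "curvature_mode \<Rightarrow> (real^'d \<Rightarrow> real) \<Rightarrow> real \<Rightarrow> real^'d \<Rightarrow> real^'d \<Rightarrow> real^'d" where
  "sample_y Option_I F r w \<sigma> = gradient F w - gradient F (sample_point r w \<sigma>)"
| "sample_y Option_II F r w \<sigma> = hessian F w *v sample_s r w \<sigma>"

definition slbfgs_B ::
  "curvature_mode \<Rightarrow> (real^'d \<Rightarrow> real) \<Rightarrow> real \<Rightarrow> nat \<Rightarrow> real^'d \<Rightarrow> (nat \<Rightarrow> real^'d) \<Rightarrow> nat \<Rightarrow> real^'d^'d"
where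
  "slbfgs_B opt F r m w \<sigma> l =
     bfgs_matrix (\<lambda>j. sample_s r w (\<sigma> j)) (\<lambda>j. sample_y opt F r w (\<sigma> j)) l m"

definition slbfgs_H ::
  "curvature_mode \<Rightarrow> (real^'d \<Rightarrow> real) \<Rightarrow> real \<Rightarrow> nat \<Rightarrow> real^'d \<Rightarrow> (nat \<Rightarrow> real^'d) \<Rightarrow> nat \<Rightarrow> real^'d^'d"
where
  "slbfgs_H opt F r m w \<sigma> l = matrix_inv (slbfgs_B opt F r m w \<sigma> l)"

text \<open>
  One run of the method: \<open>w k\<close>, \<open>H k\<close>, \<open>\<alpha> k\<close> are the iterate, the inverse Hessian approximation
  and the step length. The random choices of iteration \<open>k\<close> appear through their outcomes, the
  directions \<open>\<sigma> k 1, \<dots>, \<sigma> k m\<close> and the index \<open>l k\<close>. A statement about all runs is thus a statement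
  about every realization, whatever the distribution of the choices.
\<close>
definition slbfgs_run ::
  "curvature_mode \<Rightarrow> (real^'d \<Rightarrow> real) \<Rightarrow> real \<Rightarrow> nat \<Rightarrow> (nat \<Rightarrow> nat \<Rightarrow> real^'d) \<Rightarrow> (nat \<Rightarrow> nat)
     \<Rightarrow> (nat \<Rightarrow> real) \<Rightarrow> (nat \<Rightarrow> real^'d) \<Rightarrow> (nat \<Rightarrow> real^'d^'d) \<Rightarrow> bool"
where
  "slbfgs_run opt F r m \<sigma> l \<alpha> w H \<longleftrightarrow>
     (\<forall>k. (\<forall>j\<in>{1..m}. \<sigma> k j \<noteq> 0) \<and> l k \<in> {1..m} \<and>
          H k = slbfgs_H opt F r m (w k) (\<sigma> k) (l k) \<and>
          w (Suc k) = w k - \<alpha> k *\<^sub>R (H k *v gradient F (w k)))"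

definition armijo ::
  "(real^'d \<Rightarrow> real) \<Rightarrow> real \<Rightarrow> real^'d \<Rightarrow> real^'d^'d \<Rightarrow> real \<Rightarrow> bool" where
  "armijo F c w H a \<longleftrightarrow>
     F (w - a *\<^sub>R (H *v gradient F w)) \<le> F w - c * a * (gradient F w \<bullet> (H *v gradient F w))"

definition is_maximum :: "real set \<Rightarrow> real \<Rightarrow> bool" where
  "is_maximum S a \<longleftrightarrow> a \<in> S \<and> (\<forall>b\<in>S. b \<le> a)"

end

(*
  Taylor expansion along a line gives the descent inequality and the Polyak-Lojasiewicz
  inequality |g|^2 >= 2 mu (F - F_star), where g is the gradient. It therefore suffices that each
  step decreases F by at least 2 c_1 (1 - c_1) tau / (mu_2 L) times g^T H g.

  If the accepted step is below 1, then the preceding trial step alpha / tau was rejected, so the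
  descent inequality bounds alpha from below by 2 (1 - c_1) tau / (mu_2 L). If alpha = 1, a bound on
  mu_2 L is needed as well, and it comes from the form of H: the BFGS matrix is positive definite,
  hence invertible, and satisfies the last secant equation, so H y = s with y^T s <= L |s|^2, which
  forces mu_2 L >= 1.
*)
theory Submission
  imports Defs
begin

section \<open>Gradient and Hessian as derivatives; expansions along a line\<close>

text \<open>A real-valued linear map is the inner product with the image of 1 under its adjoint.
  This supplies the witness for the definite description in \<open>gradient\<close>; uniqueness of
  derivatives does the rest.\<close>

lemma gderiv_gradient:
  assumes "F differentiable (at x)"
  shows "GDERIV F x :> gradient F x"
proof -
  from assms obtain F' where F': "(F has_derivative F') (at x)"
    unfolding differentiable_def by blast
  then have "linear F'" by (rule has_derivative_linear)
  then have "F' = (\<lambda>h. h \<bullet> adjoint F' 1)"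
    using adjoint_works[of F' _ 1] by (auto simp: fun_eq_iff)
  with F' have ex: "GDERIV F x :> adjoint F' 1"
    unfolding gderiv_def by simp
  have uniq: "g = adjoint F' 1" if "GDERIV F x :> g" for g
  proof -
    have "(\<lambda>h. h \<bullet> g) = (\<lambda>h. h \<bullet> adjoint F' 1)"
      using that ex unfolding gderiv_def by (rule has_derivative_unique)
    then show ?thesis
      using vector_eq_ldot[of g "adjoint F' 1"] by (simp add: fun_eq_iff)
  qed
  show ?thesis
    unfolding gradient_def by (rule theI[of "\<lambda>g. GDERIV F x :> g", OF ex uniq])
qed

lemma has_derivative_gradient:
  assumes "gradient F differentiable (at x)"
  shows "(gradient F has_derivative (\<lambda>h. hessian F x *v h)) (at x)"
  using assms unfolding hessian_def by (simp add: jacobian_works)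

lemma DERIV_along_line:
  assumes "twice_cont_differentiable F"
  shows "((\<lambda>t. F (x + t *\<^sub>R d)) has_real_derivative gradient F (x + t *\<^sub>R d) \<bullet> d) (at t)"
    and "((\<lambda>t. gradient F (x + t *\<^sub>R d) \<bullet> d)
           has_real_derivative d \<bullet> (hessian F (x + t *\<^sub>R d) *v d)) (at t)"
proof -
  have line: "((\<lambda>t. x + t *\<^sub>R d) has_derivative (\<lambda>s. s *\<^sub>R d)) (at t)"
    by (auto intro!: derivative_eq_intros)
  have F: "(F has_derivative (\<lambda>h. h \<bullet> gradient F y)) (at y)" for y
    using assms gderiv_gradient unfolding twice_cont_differentiable_def gderiv_def by blast
  have G: "(gradient F has_derivative (\<lambda>h. hessian F y *v h)) (at y)" for y
    using assms has_derivative_gradient unfolding twice_cont_differentiable_def by blast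
  show "((\<lambda>t. F (x + t *\<^sub>R d)) has_real_derivative gradient F (x + t *\<^sub>R d) \<bullet> d) (at t)"
    by (rule has_derivative_imp_has_field_derivative[OF has_derivative_compose[OF line F]])
       (simp add: inner_commute)
  have "((\<lambda>t. gradient F (x + t *\<^sub>R d) \<bullet> d) has_derivative
          (\<lambda>s. (hessian F (x + t *\<^sub>R d) *v (s *\<^sub>R d)) \<bullet> d)) (at t)"
    by (intro has_derivative_inner_left has_derivative_compose[OF line G])
  then show "((\<lambda>t. gradient F (x + t *\<^sub>R d) \<bullet> d)
           has_real_derivative d \<bullet> (hessian F (x + t *\<^sub>R d) *v d)) (at t)"
    by (rule has_derivative_imp_has_field_derivative)
       (simp add: inner_commute matrix_vector_mult_scaleR)
qed

text \<open>The mean value theorem needs a scalar function, hence the projection of the gradient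
  difference onto \<open>d\<close>. This turns the curvature of Option I into a Hessian quadratic
  form.\<close>

lemma gradient_mvt:
  assumes "twice_cont_differentiable F"
  obtains \<xi> where "(gradient F (x + d) - gradient F x) \<bullet> d = d \<bullet> (hessian F \<xi> *v d)"
proof -
  from MVT2[of 0 1 "\<lambda>t. gradient F (x + t *\<^sub>R d) \<bullet> d", OF _ DERIV_along_line(2)[OF assms]]
  obtain t :: real where "gradient F (x + 1 *\<^sub>R d) \<bullet> d - gradient F (x + 0 *\<^sub>R d) \<bullet> d
      = (1 - 0) * (d \<bullet> (hessian F (x + t *\<^sub>R d) *v d))"
    by auto
  then show thesis
    by (intro that[of "x + t *\<^sub>R d"]) (simp add: inner_diff_left)
qed

lemma taylor_second_order:
  assumes "twice_cont_differentiable F"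
  obtains \<xi> where "F (x + d) = F x + gradient F x \<bullet> d + (d \<bullet> (hessian F \<xi> *v d)) / 2"
proof -
  \<comment> \<open>The derivatives of F along the line, in the shape that \<open>Maclaurin\<close>
    expects. Order 2 only asks for the derivatives of \<open>diff 0\<close> and
    \<open>diff 1\<close>, so the values beyond \<open>diff 2\<close> are arbitrary.\<close>
  define diff :: "nat \<Rightarrow> real \<Rightarrow> real" where
    "diff n t = (if n = 0 then F (x + t *\<^sub>R d)
       else if n = 1 then gradient F (x + t *\<^sub>R d) \<bullet> d
       else d \<bullet> (hessian F (x + t *\<^sub>R d) *v d))" for n t
  have "DERIV (diff n) t :> diff (Suc n) t" if "n < 2" for n t
    using that DERIV_along_line[OF assms, of x d t]
    by (cases "n = 0") (simp_all add: diff_def[abs_def])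
  then obtain t where "diff 0 1 = (\<Sum>n<2. diff n 0 / fact n * 1 ^ n) + diff 2 t / fact 2 * 1 ^ 2"
    using Maclaurin[of 1 2 diff "diff 0"] by auto
  then show thesis
    by (intro that[of "x + t *\<^sub>R d"]) (simp add: diff_def numeral_2_eq_2)
qed

section \<open>Loewner bounds and symmetric matrices\<close>

lemma loewner_le_inner:
  assumes "A \<preceq>\<^sub>L B"
  shows "x \<bullet> (A *v x) \<le> x \<bullet> (B *v x)"
  using assms unfolding loewner_le_def psd_def
  by (simp add: matrix_vector_mult_diff_rdistrib inner_diff_right)

lemma transpose_diff:
  fixes A B :: "'a::ab_group_add^'n^'m"
  shows "transpose (A - B) = transpose A - transpose B"
  by (simp add: transpose_def vec_eq_iff)

text \<open>Symmetry is part of \<open>psd\<close>, so it passes from the difference to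
  \<open>A\<close>. The theorem obtains the symmetry of each \<open>H k\<close> in this way.\<close>

lemma symmetric_of_scaled_identity_loewner_le:
  assumes "c *\<^sub>R mat 1 \<preceq>\<^sub>L A"
  shows "transpose A = A"
proof -
  have "transpose (c *\<^sub>R mat 1 :: real^'a^'a) = c *\<^sub>R mat 1"
    by (auto simp: transpose_def vec_eq_iff mat_def)
  with assms show ?thesis
    unfolding loewner_le_def psd_def by (simp add: transpose_diff)
qed

lemma symmetric_inner:
  fixes A :: "real^'n^'n"
  assumes "transpose A = A"
  shows "x \<bullet> (A *v y) = y \<bullet> (A *v x)"
  using dot_lmul_matrix[of x A y] transpose_matrix_vector[of A x] assms by (simp add: inner_commute)

text \<open>This is A^2 \<le> M A for 0 \<le> A \<le> M I, obtained without eigenvalues by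
  evaluating the form of \<open>A\<close> at M g - A g.\<close>

lemma norm_sq_matrix_vector_le:
  fixes A :: "real^'n^'n"
  assumes sym: "transpose A = A"
    and nonneg: "\<And>x. 0 \<le> x \<bullet> (A *v x)"
    and upper: "\<And>x. x \<bullet> (A *v x) \<le> M * (x \<bullet> x)"
    and "0 < M"
  shows "(A *v g) \<bullet> (A *v g) \<le> M * (g \<bullet> (A *v g))"
proof -
  define v where "v = A *v g"
  have "0 \<le> (M *\<^sub>R g - v) \<bullet> (A *v (M *\<^sub>R g - v))"
    by (rule nonneg)
  also have "\<dots> = M * (M * (g \<bullet> v)) - 2 * M * (v \<bullet> v) + v \<bullet> (A *v v)"
    using symmetric_inner[OF sym, of g v]
    by (simp add: matrix_vector_mult_diff_distrib matrix_vector_mult_scaleR inner_diff_left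
        inner_diff_right v_def[symmetric] algebra_simps inner_commute)
  also have "\<dots> \<le> M * (M * (g \<bullet> v) - v \<bullet> v)"
    using upper[of v] by (simp add: algebra_simps)
  finally show ?thesis
    using \<open>0 < M\<close> by (simp add: zero_le_mult_iff v_def)
qed

section \<open>BFGS updates: positive definiteness and the secant equation\<close>

text \<open>Symmetry is phrased through the bilinear form because the update is handled through its
  action on vectors.\<close>

definition spd :: "real^'n^'n \<Rightarrow> bool" where
  "spd B \<longleftrightarrow> (\<forall>x y. x \<bullet> (B *v y) = y \<bullet> (B *v x)) \<and> (\<forall>x. x \<noteq> 0 \<longrightarrow> 0 < x \<bullet> (B *v x))"

lemma spd_imp_invertible:
  assumes "spd B"
  shows "invertible B"
proof -
  have "x = 0" if "B *v x = 0" for x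
    using assms that unfolding spd_def by (metis inner_zero_right less_irrefl)
  then show ?thesis
    using invertible_left_inverse matrix_left_invertible_ker by blast
qed

lemma outer_product_mult_vector: "outer_product u v *v x = (v \<bullet> x) *\<^sub>R u"
  by (simp add: outer_product_def vec_eq_iff matrix_vector_mult_def matrix_matrix_mult_def
      columnvector_def rowvector_def inner_vec_def sum_distrib_left sum_distrib_right mult_ac)

lemma bfgs_update_mult_vector:
  "bfgs_update B s y *v x =
    B *v x - ((s \<bullet> (B *v x)) / (s \<bullet> (B *v s))) *\<^sub>R (B *v s) + ((y \<bullet> x) / (y \<bullet> s)) *\<^sub>R y"
  by (simp add: bfgs_update_def matrix_vector_mult_add_rdistrib matrix_vector_mult_diff_rdistrib
      scaleR_matrix_vector_assoc[symmetric] matrix_vector_mul_assoc[symmetric]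
      outer_product_mult_vector matrix_vector_mult_scaleR)

text \<open>At \<open>s\<close> both quotients in the update equal 1, so B s cancels and only
  \<open>y\<close> remains.\<close>

lemma bfgs_secant:
  assumes "spd B" "s \<noteq> 0" "0 < y \<bullet> s"
  shows "bfgs_update B s y *v s = y"
proof -
  have "s \<bullet> (B *v s) \<noteq> 0"
    using assms(1,2) unfolding spd_def by force
  then show ?thesis
    using assms by (simp add: bfgs_update_mult_vector)
qed

text \<open>The new quadratic form at x is z^T B z + (y^T x)^2 / (y^T s), where z is the part of x
  that is B-orthogonal to s. Both terms are nonnegative and they do not vanish together.\<close>

lemma spd_bfgs_update:
  assumes B: "spd B" and s: "s \<noteq> 0" and ys: "0 < y \<bullet> s"
  shows "spd (bfgs_update B s y)"
  unfolding spd_def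
proof (intro conjI allI impI)
  have sym: "u \<bullet> (B *v v) = v \<bullet> (B *v u)" for u v
    using B unfolding spd_def by blast
  fix u v :: "real^'a"
  show "u \<bullet> (bfgs_update B s y *v v) = v \<bullet> (bfgs_update B s y *v u)"
    using sym[of u v] sym[of u s] sym[of v s]
    by (simp add: bfgs_update_mult_vector inner_add_right inner_diff_right
        inner_commute mult_ac)
next
  have sym: "u \<bullet> (B *v v) = v \<bullet> (B *v u)" for u v
    using B unfolding spd_def by blast
  have pos: "0 < u \<bullet> (B *v u)" if "u \<noteq> 0" for u
    using B that unfolding spd_def by blast
  fix x :: "real^'a"
  assume x: "x \<noteq> 0"
  define b where "b = s \<bullet> (B *v s)"
  \<comment> \<open>Coefficient of the B-orthogonal projection of \<open>x\<close> onto
    \<open>s\<close>.\<close>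
  define t where "t = (s \<bullet> (B *v x)) / b"
  define z where "z = x - t *\<^sub>R s"
  have b: "0 < b" using pos[OF s] by (simp add: b_def)
  have tb: "s \<bullet> (B *v x) = t * b" using b by (simp add: t_def)
  have "z \<bullet> (B *v z) = x \<bullet> (B *v x) - t * (s \<bullet> (B *v x))"
    using sym[of x s] tb
    by (simp add: z_def matrix_vector_mult_diff_distrib matrix_vector_mult_scaleR
        inner_diff_left inner_diff_right b_def[symmetric] algebra_simps)
  then have eq: "x \<bullet> (bfgs_update B s y *v x) = z \<bullet> (B *v z) + (y \<bullet> x)\<^sup>2 / (y \<bullet> s)"
    using sym[of x s]
    by (simp add: bfgs_update_mult_vector inner_add_right inner_diff_right
        t_def b_def inner_commute[of x y] power2_eq_square)
  show "0 < x \<bullet> (bfgs_update B s y *v x)"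
  proof (cases "z = 0")
    case True
    \<comment> \<open>Here \<open>x\<close> is a nonzero multiple of \<open>s\<close>, so the second
      term is t^2 (y^T s) > 0.\<close>
    then have xt: "x = t *\<^sub>R s" by (simp add: z_def)
    with x have "t \<noteq> 0" by auto
    then show ?thesis using eq ys by (simp add: True xt)
  next
    case False
    then show ?thesis using eq pos[OF False] ys
      by (simp add: add_pos_nonneg)
  qed
qed

lemma spd_scaled_identity: "0 < c \<Longrightarrow> spd (c *\<^sub>R mat 1 :: real^'n^'n)"
  by (simp add: spd_def scaleR_matrix_vector_assoc[symmetric] inner_commute)

lemma spd_bfgs_matrix:
  assumes "l \<in> {1..m}" and "\<And>j. j \<in> {1..m} \<Longrightarrow> s j \<noteq> 0 \<and> 0 < y j \<bullet> s j" and "i \<le> m"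
  shows "spd (bfgs_matrix s y l i)"
  using assms(3)
proof (induction i)
  case 0
  have "0 < y l \<bullet> s l" using assms by blast
  then have "0 < (y l \<bullet> y l) / (s l \<bullet> y l)"
    by (intro divide_pos_pos) (auto simp: inner_commute)
  then show ?case by (simp add: spd_scaled_identity)
next
  case (Suc i)
  then show ?case using assms(2)[of "Suc i"] by (simp add: spd_bfgs_update)
qed

text \<open>Only the last pair is treated: a later update need not preserve the secant equations of
  earlier pairs.\<close>

lemma bfgs_matrix_inv_secant:
  assumes "l \<in> {1..m}" and "\<And>j. j \<in> {1..m} \<Longrightarrow> s j \<noteq> 0 \<and> 0 < y j \<bullet> s j"
  shows "matrix_inv (bfgs_matrix s y l m) *v y m = s m"
proof -
  from assms(1) obtain n where m: "m = Suc n" by (cases m) auto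
  have sm: "s m \<noteq> 0" "0 < y m \<bullet> s m" using assms(2)[of m] m by auto
  have "spd (bfgs_matrix s y l n)" using spd_bfgs_matrix[OF assms] m by simp
  then have secant: "bfgs_matrix s y l m *v s m = y m"
    using sm unfolding m by (simp add: bfgs_secant)
  have "invertible (bfgs_matrix s y l m)"
    by (rule spd_imp_invertible) (rule spd_bfgs_matrix[OF assms order_refl])
  \<comment> \<open>\<open>matrix_inv\<close> is a Hilbert choice; invertibility guarantees that the
    chosen matrix is an inverse.\<close>
  from someI_ex[OF this[unfolded invertible_def]]
  have "matrix_inv (bfgs_matrix s y l m) ** bfgs_matrix s y l m = mat 1"
    unfolding matrix_inv_def by blast
  then show ?thesis
    by (metis secant matrix_vector_mul_assoc matrix_vector_mul_lid)
qed

section \<open>Consequences of the Hessian bounds\<close>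

text \<open>Under either option y^T s is a Hessian quadratic form in s, at an intermediate point for
  Option I and at \<open>w\<close> for Option II, so the Loewner bounds cover both.\<close>

lemma sample_curvature:
  assumes "twice_cont_differentiable F"
    and "\<And>x. \<mu> *\<^sub>R mat 1 \<preceq>\<^sub>L hessian F x"
    and "\<And>x. hessian F x \<preceq>\<^sub>L L *\<^sub>R mat 1"
  shows "\<mu> * (sample_s r w \<sigma> \<bullet> sample_s r w \<sigma>) \<le> sample_y opt F r w \<sigma> \<bullet> sample_s r w \<sigma>"
    and "sample_y opt F r w \<sigma> \<bullet> sample_s r w \<sigma> \<le> L * (sample_s r w \<sigma> \<bullet> sample_s r w \<sigma>)"
proof -
  define s where "s = sample_s r w \<sigma>"
  have "\<exists>\<xi>. sample_y opt F r w \<sigma> \<bullet> s = s \<bullet> (hessian F \<xi> *v s)"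
  proof (cases opt)
    case Option_I
    obtain \<xi> where "(gradient F (sample_point r w \<sigma> + s) - gradient F (sample_point r w \<sigma>)) \<bullet> s
        = s \<bullet> (hessian F \<xi> *v s)"
      using gradient_mvt[OF assms(1)] .
    then show ?thesis using Option_I by (auto simp: s_def sample_s_def)
  next
    case Option_II
    then show ?thesis by (auto simp: s_def inner_commute)
  qed
  then obtain \<xi> where "sample_y opt F r w \<sigma> \<bullet> s = s \<bullet> (hessian F \<xi> *v s)" ..
  with loewner_le_inner[OF assms(2), of s \<xi>] loewner_le_inner[OF assms(3), of s \<xi>]
  show "\<mu> * (sample_s r w \<sigma> \<bullet> sample_s r w \<sigma>) \<le> sample_y opt F r w \<sigma> \<bullet> sample_s r w \<sigma>"
    "sample_y opt F r w \<sigma> \<bullet> sample_s r w \<sigma> \<le> L * (sample_s r w \<sigma> \<bullet> sample_s r w \<sigma>)"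
    by (simp_all add: s_def scaleR_matrix_vector_assoc[symmetric])
qed

lemma descent_bound:
  assumes "twice_cont_differentiable F"
    and "\<And>x. hessian F x \<preceq>\<^sub>L L *\<^sub>R mat 1"
  shows "F (x - a *\<^sub>R v) \<le> F x - a * (gradient F x \<bullet> v) + a\<^sup>2 * L / 2 * (v \<bullet> v)"
proof -
  obtain \<xi> where "F (x + (- a) *\<^sub>R v) = F x + gradient F x \<bullet> ((- a) *\<^sub>R v)
      + (((- a) *\<^sub>R v) \<bullet> (hessian F \<xi> *v ((- a) *\<^sub>R v))) / 2"
    using taylor_second_order[OF assms(1)] .
  moreover have "((- a) *\<^sub>R v) \<bullet> (hessian F \<xi> *v ((- a) *\<^sub>R v)) \<le> a\<^sup>2 * L * (v \<bullet> v)"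
    using loewner_le_inner[OF assms(2), of "(- a) *\<^sub>R v" \<xi>]
    by (simp add: scaleR_matrix_vector_assoc[symmetric] power2_eq_square mult_ac)
  ultimately show ?thesis by simp
qed

lemma polyak_lojasiewicz:
  assumes "twice_cont_differentiable F" and "0 < \<mu>"
    and "\<And>x. \<mu> *\<^sub>R mat 1 \<preceq>\<^sub>L hessian F x"
  shows "2 * \<mu> * (F x - F z) \<le> gradient F x \<bullet> gradient F x"
proof -
  define d where "d = z - x"
  define g where "g = gradient F x"
  obtain \<xi> where "F (x + d) = F x + g \<bullet> d + (d \<bullet> (hessian F \<xi> *v d)) / 2"
    using taylor_second_order[OF assms(1)] unfolding g_def .
  then have "F x + g \<bullet> d + \<mu> / 2 * (d \<bullet> d) \<le> F z"
    using loewner_le_inner[OF assms(3), of d \<xi>]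
    by (simp add: scaleR_matrix_vector_assoc[symmetric] d_def)
  then have "\<mu> * (F x + g \<bullet> d + \<mu> / 2 * (d \<bullet> d)) \<le> \<mu> * F z"
    using assms(2) by simp
  \<comment> \<open>Completing the square: the quadratic lower model is minimal at d = -g / \<mu>,
    where this square vanishes.\<close>
  moreover have "0 \<le> (g + \<mu> *\<^sub>R d) \<bullet> (g + \<mu> *\<^sub>R d)" by simp
  ultimately show ?thesis
    unfolding g_def[symmetric]
    by (simp add: inner_add_left inner_add_right inner_commute algebra_simps)
qed

section \<open>Decrease achieved by one backtracking step\<close>

text \<open>
  If the unit step is accepted, the Armijo condition alone does not give enough decrease when
  \<open>\<kappa>\<close> is close to 1. In that regime the descent inequality gives the factor \<open>1 - \<kappa> / 2\<close>, and
  \<open>\<kappa> / 2 * (1 - \<kappa> / 2) \<ge> c * (1 - c)\<close> because \<open>c \<le> \<kappa> / 2 \<le> 1 - c\<close>.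
\<close>
lemma unit_step_decrease:
  fixes c \<kappa> \<tau> q D :: real
  assumes "0 < c" "c < 1" "0 < \<tau>" "\<tau> < 1" "1 \<le> \<kappa>" "0 \<le> q"
    and armijo: "c * q \<le> D" and descent: "(1 - \<kappa> / 2) * q \<le> D"
  shows "2 * c * (1 - c) * \<tau> / \<kappa> * q \<le> D"
proof (cases "2 * (1 - c) \<le> \<kappa>")
  case True
  have "2 * (1 - c) * \<tau> \<le> \<kappa>"
    using assms(1-4) by (intro order_trans[OF mult_left_le True]) auto
  then have "2 * c * (1 - c) * \<tau> / \<kappa> \<le> c"
    using assms by (simp add: divide_simps mult_ac)
  then show ?thesis
    using armijo mult_right_mono[OF _ \<open>0 \<le> q\<close>] order_trans by blast
next
  case False
  \<comment> \<open>In this case 2 (1 - c) > \<kappa> \<ge> 1, so c < 1/2 \<le> \<kappa> / 2 and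
    both factors are nonnegative.\<close>
  have "0 \<le> (\<kappa> / 2 - c) * (1 - c - \<kappa> / 2)"
    using False assms by (intro mult_nonneg_nonneg) auto
  then have "2 * c * (1 - c) \<le> (1 - \<kappa> / 2) * \<kappa>"
    by (simp add: algebra_simps)
  moreover have "2 * c * (1 - c) * \<tau> \<le> 2 * c * (1 - c)"
    using assms by (intro mult_left_le) auto
  ultimately have "2 * c * (1 - c) * \<tau> \<le> (1 - \<kappa> / 2) * \<kappa>"
    by linarith
  then have "2 * c * (1 - c) * \<tau> / \<kappa> \<le> 1 - \<kappa> / 2"
    using assms by (simp add: pos_divide_le_eq)
  then show ?thesis
    using descent mult_right_mono[OF _ \<open>0 \<le> q\<close>] order_trans by blast
qed

text \<open>The bound on v^T v rewrites the descent inequality in terms of g^T v alone, so that it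
  can be compared with the Armijo condition.\<close>

lemma backtracking_decrease:
  fixes H :: "real^'d^'d"
  assumes F: "twice_cont_differentiable F" and "0 < L"
    and hess: "\<And>x. hessian F x \<preceq>\<^sub>L L *\<^sub>R mat 1"
    and c: "0 < c" "c < 1" and \<tau>: "0 < \<tau>" "\<tau> < 1"
    and "1 \<le> M * L"
    and g: "g = gradient F w" and v: "v = H *v g"
    and q: "0 \<le> g \<bullet> v" and vv: "v \<bullet> v \<le> M * (g \<bullet> v)"
    and max: "is_maximum {a. (\<exists>j::nat. a = \<tau> ^ j) \<and> armijo F c w H a} \<alpha>"
  shows "2 * c * (1 - c) * \<tau> / (M * L) * (g \<bullet> v) \<le> F w - F (w - \<alpha> *\<^sub>R v)"
proof -
  obtain j where j: "\<alpha> = \<tau> ^ j" and acc: "c * \<alpha> * (g \<bullet> v) \<le> F w - F (w - \<alpha> *\<^sub>R v)"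
    using max unfolding is_maximum_def armijo_def g v by auto
  have desc: "F (w - a *\<^sub>R v) \<le> F w - a * (g \<bullet> v) + a\<^sup>2 * (M * L) / 2 * (g \<bullet> v)" for a
  proof -
    have "a\<^sup>2 * L / 2 * (v \<bullet> v) \<le> a\<^sup>2 * L / 2 * (M * (g \<bullet> v))"
      using vv \<open>0 < L\<close> by (intro mult_left_mono) auto
    with descent_bound[OF F hess, of w a v] show ?thesis
      by (simp add: g mult_ac)
  qed
  show ?thesis
  proof (cases j)
    case 0
    then have "\<alpha> = 1" using j by simp
    show ?thesis
    proof (rule unit_step_decrease[OF c \<tau> \<open>1 \<le> M * L\<close> q])
      show "c * (g \<bullet> v) \<le> F w - F (w - \<alpha> *\<^sub>R v)"
        using acc \<open>\<alpha> = 1\<close> by simp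
      show "(1 - M * L / 2) * (g \<bullet> v) \<le> F w - F (w - \<alpha> *\<^sub>R v)"
        using desc[of 1] \<open>\<alpha> = 1\<close> by (simp add: algebra_simps)
    qed
  next
    case (Suc i)
    \<comment> \<open>\<open>b\<close> is \<alpha> / \<tau>, a larger trial step, which must violate
      the Armijo condition by maximality of \<alpha>.\<close>
    define b where "b = \<tau> ^ i"
    have b: "0 < b" "\<alpha> = \<tau> * b" using \<tau> by (auto simp: b_def j Suc)
    then have "\<alpha> < b" using \<tau> by simp
    have "\<not> armijo F c w H b"
      using max \<open>\<alpha> < b\<close> unfolding is_maximum_def b_def by force
    then have "F w - c * b * (g \<bullet> v) < F (w - b *\<^sub>R v)"
      unfolding armijo_def g v by simp
    with desc[of b] have "0 < (b * (g \<bullet> v)) * (b * (M * L) / 2 - (1 - c))"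
      by (simp add: algebra_simps power2_eq_square)
    \<comment> \<open>The factor b g^T v is nonnegative, so strict positivity of the product forces
      the other factor to be positive; multiplying by \<tau> then bounds \<alpha> from
      below.\<close>
    then have "0 < b * (M * L) / 2 - (1 - c)"
      using b q by (meson zero_less_mult_pos mult_nonneg_nonneg not_less order_less_imp_le
          mult_nonneg_nonpos)
    then have "2 * (1 - c) * \<tau> \<le> \<alpha> * (M * L)"
      using mult_left_mono[of "2 * (1 - c)" "b * (M * L)" \<tau>] \<tau> by (simp add: b mult_ac)
    then have "c * (2 * (1 - c) * \<tau>) \<le> c * (\<alpha> * (M * L))"
      using c by simp
    then have "2 * c * (1 - c) * \<tau> / (M * L) \<le> c * \<alpha>"
      using \<open>1 \<le> M * L\<close> by (simp add: pos_divide_le_eq mult_ac)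
    then show ?thesis
      using acc mult_right_mono[OF _ q] order_trans by blast
  qed
qed

theorem theorem5p3:
  fixes F :: "real^'d \<Rightarrow> real"
    and w :: "nat \<Rightarrow> real^'d" and wstar :: "real^'d"
    and H :: "nat \<Rightarrow> real^'d^'d"
    and \<sigma> :: "nat \<Rightarrow> nat \<Rightarrow> real^'d" and l :: "nat \<Rightarrow> nat"
    and \<alpha> :: "nat \<Rightarrow> real" and opt :: curvature_mode
    and m :: nat and r \<mu> L \<mu>\<^sub>1 \<mu>\<^sub>2 c\<^sub>1 \<tau> :: real
  assumes "twice_cont_differentiable F"
    and "0 < \<mu>" and "0 < L"
    and "\<And>x. \<mu> *\<^sub>R mat 1 \<preceq>\<^sub>L hessian F x"
    and "\<And>x. hessian F x \<preceq>\<^sub>L L *\<^sub>R mat 1"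
    and "\<And>x. F wstar \<le> F x"
    and "1 \<le> m" and "0 < r"
    and "slbfgs_run opt F r m \<sigma> l \<alpha> w H"
    and "0 < \<mu>\<^sub>1" and "\<mu>\<^sub>1 \<le> \<mu>\<^sub>2"
    and "\<And>k. \<mu>\<^sub>1 *\<^sub>R mat 1 \<preceq>\<^sub>L H k"
    and "\<And>k. H k \<preceq>\<^sub>L \<mu>\<^sub>2 *\<^sub>R mat 1"
    and "0 < c\<^sub>1" and "c\<^sub>1 < 1"
    and "0 < \<tau>" and "\<tau> < 1"
    and "\<And>k. is_maximum {a. (\<exists>j::nat. a = \<tau> ^ j) \<and> armijo F c\<^sub>1 (w k) (H k) a} (\<alpha> k)"
  shows "\<forall>k. F (w k) - F wstar \<le>
           (1 - 4 * \<mu> * \<mu>\<^sub>1\<^sup>2 * c\<^sub>1 * (1 - c\<^sub>1) * \<tau> / (\<mu>\<^sub>2\<^sup>2 * L)) ^ k * (F (w 0) - F wstar)"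
proof -
  have "0 < \<mu>\<^sub>2" using assms(10,11) by linarith
  have run: "\<And>j. j \<in> {1..m} \<Longrightarrow> \<sigma> k j \<noteq> 0" "l k \<in> {1..m}"
    "H k = slbfgs_H opt F r m (w k) (\<sigma> k) (l k)"
    "w (Suc k) = w k - \<alpha> k *\<^sub>R (H k *v gradient F (w k))" for k
    using assms(9) unfolding slbfgs_run_def by blast+
  have H_lower: "\<mu>\<^sub>1 * (x \<bullet> x) \<le> x \<bullet> (H k *v x)" for k x
    using loewner_le_inner[OF assms(12), of x k] by (simp add: scaleR_matrix_vector_assoc[symmetric])
  have H_upper: "x \<bullet> (H k *v x) \<le> \<mu>\<^sub>2 * (x \<bullet> x)" for k x
    using loewner_le_inner[OF assms(13), of x k] by (simp add: scaleR_matrix_vector_assoc[symmetric])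
  have H_nonneg: "0 \<le> x \<bullet> (H k *v x)" for k x
    using H_lower[of x k] assms(10) order_trans[of 0 "\<mu>\<^sub>1 * (x \<bullet> x)"] by simp
  have H_sq: "(H k *v x) \<bullet> (H k *v x) \<le> \<mu>\<^sub>2 * (x \<bullet> (H k *v x))" for k x
    using symmetric_of_scaled_identity_loewner_le[OF assms(12)] H_nonneg H_upper \<open>0 < \<mu>\<^sub>2\<close>
    by (rule norm_sq_matrix_vector_le)

  \<comment> \<open>The constant \<open>\<mu>\<^sub>2\<close> is common to all iterations, so the
    pairs of iteration 0 suffice to bound \<open>\<mu>\<^sub>2 * L\<close> from below.\<close>
  define s where "s j = sample_s r (w 0) (\<sigma> 0 j)" for j
  define y where "y j = sample_y opt F r (w 0) (\<sigma> 0 j)" for j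
  have curv: "\<mu> * (s j \<bullet> s j) \<le> y j \<bullet> s j" "y j \<bullet> s j \<le> L * (s j \<bullet> s j)" for j
    unfolding s_def y_def by (rule sample_curvature[OF assms(1,4,5)])+
  have s_nz: "s j \<noteq> 0" if "j \<in> {1..m}" for j
    using run(1)[OF that, of 0] assms(8) by (simp add: s_def sample_s_def sample_point_def)
  have "0 < y j \<bullet> s j" if "j \<in> {1..m}" for j
    using curv(1)[of j] s_nz[OF that] assms(2)
    by (meson inner_gt_zero_iff mult_pos_pos less_le_trans)
  then have "matrix_inv (bfgs_matrix s y (l 0) m) *v y m = s m"
    using s_nz by (intro bfgs_matrix_inv_secant[OF run(2)]) auto
  then have secant: "H 0 *v y m = s m"
    by (simp add: run(3) slbfgs_H_def slbfgs_B_def s_def[abs_def] y_def[abs_def])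
  have ss: "0 < s m \<bullet> s m" using s_nz[of m] assms(7) by simp
  \<comment> \<open>The nonzero vector \<open>s m\<close> also compares the two Hessian
    bounds.\<close>
  have "\<mu> * (s m \<bullet> s m) \<le> L * (s m \<bullet> s m)" using curv[of m] by linarith
  then have "\<mu> \<le> L" using ss by simp
  \<comment> \<open>Since H y = s, the bound |H y|^2 \<le> \<open>\<mu>\<^sub>2\<close> y^T H y
    becomes |s|^2 \<le> \<open>\<mu>\<^sub>2\<close> y^T s.\<close>
  have "s m \<bullet> s m \<le> \<mu>\<^sub>2 * (y m \<bullet> s m)"
    using H_sq[of 0 "y m"] by (simp add: secant)
  also have "\<dots> \<le> \<mu>\<^sub>2 * (L * (s m \<bullet> s m))"
    using curv(2)[of m] \<open>0 < \<mu>\<^sub>2\<close> by simp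
  finally have "1 * (s m \<bullet> s m) \<le> (\<mu>\<^sub>2 * L) * (s m \<bullet> s m)"
    by (simp add: mult_ac)
  then have \<kappa>: "1 \<le> \<mu>\<^sub>2 * L"
    using ss mult_le_cancel_right_pos by blast

  define \<theta> where "\<theta> = 2 * c\<^sub>1 * (1 - c\<^sub>1) * \<tau> / (\<mu>\<^sub>2 * L)"
  define \<rho> where "\<rho> = 4 * \<mu> * \<mu>\<^sub>1\<^sup>2 * c\<^sub>1 * (1 - c\<^sub>1) * \<tau> / (\<mu>\<^sub>2\<^sup>2 * L)"
  have \<theta>_nonneg: "0 \<le> \<theta>" using assms(14-17) \<kappa> by (simp add: \<theta>_def)
  \<comment> \<open>The chain of estimates below yields the contraction factor
    \<open>1 - \<theta> * \<mu>\<^sub>1 * (2 * \<mu>)\<close>; the claimed rate gives away a further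
    factor \<open>\<mu>\<^sub>1 / \<mu>\<^sub>2\<close>, which is at most 1.\<close>
  have \<rho>_eq: "\<rho> = (\<theta> * \<mu>\<^sub>1 * (2 * \<mu>)) * (\<mu>\<^sub>1 / \<mu>\<^sub>2)"
    using \<open>0 < \<mu>\<^sub>2\<close> assms(3) by (simp add: \<rho>_def \<theta>_def power2_eq_square mult_ac)
  have ratio: "\<mu>\<^sub>1 / \<mu>\<^sub>2 \<le> 1" "0 \<le> \<mu>\<^sub>1 / \<mu>\<^sub>2"
    using assms(10,11) by simp_all
  have \<rho>_le: "\<rho> \<le> \<theta> * \<mu>\<^sub>1 * (2 * \<mu>)"
    unfolding \<rho>_eq using \<theta>_nonneg assms(2,10) ratio by (intro mult_left_le) auto
  \<comment> \<open>This makes 1 - \<rho> nonnegative, so the final induction may multiply its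
    hypothesis by it. The constant \<rho> is a product of 4 c (1 - c), \<tau>, \<mu> / L and
    \<open>(\<mu>\<^sub>1 / \<mu>\<^sub>2)\<^sup>2\<close>, each at most 1.\<close>
  have "\<rho> \<le> 1"
  proof -
    have "0 \<le> (1 - 2 * c\<^sub>1)\<^sup>2" by simp
    then have "4 * c\<^sub>1 * (1 - c\<^sub>1) \<le> 1" by (simp add: power2_eq_square algebra_simps)
    then have unit1: "(4 * c\<^sub>1 * (1 - c\<^sub>1)) * \<tau> \<le> 1"
      by (rule mult_le_one) (use assms(14-17) in auto)
    have unit2: "\<mu> / L * (\<mu>\<^sub>1 / \<mu>\<^sub>2)\<^sup>2 \<le> 1"
      using \<open>\<mu> \<le> L\<close> assms(2,3) ratio by (intro mult_le_one power_le_one) auto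
    have "((4 * c\<^sub>1 * (1 - c\<^sub>1)) * \<tau>) * (\<mu> / L * (\<mu>\<^sub>1 / \<mu>\<^sub>2)\<^sup>2) \<le> 1"
      by (rule mult_le_one[OF unit1 _ unit2]) (use assms(2,3) in auto)
    moreover have "\<rho> = ((4 * c\<^sub>1 * (1 - c\<^sub>1)) * \<tau>) * (\<mu> / L * (\<mu>\<^sub>1 / \<mu>\<^sub>2)\<^sup>2)"
      by (simp only: \<rho>_def power_mult_distrib power_inverse divide_inverse inverse_mult_distrib mult_ac)
    ultimately show ?thesis by simp
  qed

  have step: "F (w (Suc k)) - F wstar \<le> (1 - \<rho>) * (F (w k) - F wstar)" for k
  proof -
    define g where "g = gradient F (w k)"
    have "\<rho> * (F (w k) - F wstar) \<le> \<theta> * \<mu>\<^sub>1 * (2 * \<mu>) * (F (w k) - F wstar)"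
      using \<rho>_le assms(6) by (intro mult_right_mono) auto
    also have "\<dots> = \<theta> * \<mu>\<^sub>1 * (2 * \<mu> * (F (w k) - F wstar))" by simp
    also have "\<dots> \<le> \<theta> * \<mu>\<^sub>1 * (g \<bullet> g)"
      unfolding g_def using \<theta>_nonneg assms(10) polyak_lojasiewicz[OF assms(1,2,4)]
      by (intro mult_left_mono) auto
    also have "\<dots> \<le> \<theta> * (g \<bullet> (H k *v g))"
      using H_lower \<theta>_nonneg by (simp add: mult.assoc mult_left_mono)
    also have "\<dots> \<le> F (w k) - F (w (Suc k))"
      unfolding run(4) \<theta>_def g_def[symmetric]
      by (rule backtracking_decrease[OF assms(1,3,5,14-17) \<kappa> g_def refl
            H_nonneg H_sq assms(18)])
    finally show ?thesis by (simp add: algebra_simps)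
  qed
  show ?thesis
    unfolding \<rho>_def[symmetric]
  proof
    fix k
    show "F (w k) - F wstar \<le> (1 - \<rho>) ^ k * (F (w 0) - F wstar)"
    proof (induction k)
      case (Suc k)
      have "(1 - \<rho>) * (F (w k) - F wstar) \<le> (1 - \<rho>) * ((1 - \<rho>) ^ k * (F (w 0) - F wstar))"
        using Suc \<open>\<rho> \<le> 1\<close> by (intro mult_left_mono) auto
      with step[of k] show ?case by (simp add: mult.assoc)
    qed simp
  qed
qed

end
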